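(* Let $\lambda\in(0,1)$ and $\gamma\in(0,1)$ with $\lambda(1+\gamma)<1$, and set $\lambda'=1-\lambda$ and $\gamma'=\frac{\lambda\gamma}{1-\lambda}$. A real polynomial $p$ is $(\lambda,\gamma)$-admissible if and only if the polynomial $x\mapsto -p(1-x)$ is $(\lambda',\gamma')$-admissible. Moreover, in this case the $(\lambda,\gamma)$-admissible gap of $p$ is identical to the $(\lambda',\gamma')$-admissible gap of $x\mapsto -p(1-x)$.
   Context: For $\lambda\in(0,1)$ and $\gamma\in(0,1)$ with $\lambda(1+\gamma)<1$, a real polynomial $p$ is said to be $(\lambda,\gamma)$-admissible if: (i) $p(\lambda)=0$; (ii) for all $x\in[0,(1-\gamma)\lambda]$, $-1\le p(x)\le p((1-\gamma)\lambda)<0$; and (iii) for all $x\in[(1+\gamma)\lambda,1]$, $0<p((1+\gamma)\lambda)\le p(x)\le 1$. The $(\lambda,\gamma)$-admissible gap of a $(\lambda,\gamma)$-admissible polynomial $p$ is $\alpha(p;\lambda,\gamma)=\min\{-p((1-\gamma)\lambda),\,p((1+\gamma)\lambda)\}$. *)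

theory Defs
  imports Complex_Main "HOL-Computational_Algebra.Polynomial"
begin

text \<open>Admissibility is only meaningful for parameters in the stated range, so the range
  constraints are part of the predicate.\<close>

definition admissible :: "real \<Rightarrow> real \<Rightarrow> real poly \<Rightarrow> bool" where
  "admissible l g p \<longleftrightarrow>
     l \<in> {0<..<1} \<and> g \<in> {0<..<1} \<and> l * (1 + g) < 1 \<and>
     poly p l = 0 \<and>
     (\<forall>x \<in> {0..(1 - g) * l}.
        - 1 \<le> poly p x \<and> poly p x \<le> poly p ((1 - g) * l) \<and> poly p ((1 - g) * l) < 0) \<and>
     (\<forall>x \<in> {(1 + g) * l..1}.
        0 < poly p ((1 + g) * l) \<and> poly p ((1 + g) * l) \<le> poly p x \<and> poly p x \<le> 1)"

definition admissible_gap :: "real \<Rightarrow> real \<Rightarrow> real poly \<Rightarrow> real" where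
  "admissible_gap l g p = min (- poly p ((1 - g) * l)) (poly p ((1 + g) * l))"

text \<open>The polynomial \<open>- pcompose p [:1, -1:]\<close> is the one with polynomial function
  \<open>x \<mapsto> - p (1 - x)\<close>.\<close>

lemma poly_neg_pcompose_one_minus:
  fixes p :: "real poly"
  shows "poly (- pcompose p [:1, -1:]) x = - poly p (1 - x)"
  by (simp add: poly_pcompose)

end

theory Submission
  imports Defs
begin

text \<open>The map \<open>x \<mapsto> 1 - x\<close> preserves [0,1] and sends \<open>l\<close> to
  \<open>l'\<close>. Since \<open>g' * l' = g * l\<close>, the gap around the root keeps its
  half-width, so the endpoints \<open>(1 - g) * l\<close> and \<open>(1 + g) * l\<close> go to
  \<open>(1 + g') * l'\<close> and \<open>(1 - g') * l'\<close>. Negating the values reverses the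
  inequalities, so conditions (ii) and (iii) change places, as do the two entries of the minimum
  defining the gap.\<close>

lemma ball_reflect_interval:
  fixes c :: "'a::linordered_idom"
  shows "(\<forall>x\<in>{a..b}. P (c - x)) \<longleftrightarrow> (\<forall>x\<in>{c - b..c - a}. P x)"
  by (simp flip: image_diff_atLeastAtMost)

theorem proposition1:
  fixes l g l' g' :: real and p :: "real poly"
  assumes "l \<in> {0<..<1}" and "g \<in> {0<..<1}" and "l * (1 + g) < 1"
    and "l' = 1 - l" and "g' = l * g / (1 - l)"
  shows "(admissible l g p \<longleftrightarrow> admissible l' g' (- pcompose p [:1, -1:])) \<and>
    (admissible l g p \<longrightarrow>
       admissible_gap l g p = admissible_gap l' g' (- pcompose p [:1, -1:]))"
proof -
  let ?q = "- pcompose p [:1, -1:]"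
  define a where "a = (1 - g) * l"
  define b where "b = (1 + g) * l"
  have lg: "g' * l' = g * l" using assms by simp
  have a': "(1 + g') * l' = 1 - a" and b': "(1 - g') * l' = 1 - b"
    unfolding a_def b_def distrib_right left_diff_distrib lg using assms(4) by simp_all
  \<comment> \<open>The constraints are exchanged too: \<open>l' * (1 + g') < 1\<close> amounts to
    \<open>0 < a\<close>, and \<open>g' < 1\<close> amounts to
    \<open>l * (1 + g) < 1\<close>.\<close>
  have range': "l' \<in> {0<..<1}" "g' \<in> {0<..<1}" "l' * (1 + g') < 1"
  proof -
    have "0 < a" using assms by (simp add: a_def)
    then show "l' * (1 + g') < 1" using a' by (simp add: mult.commute)
    show "l' \<in> {0<..<1}" "g' \<in> {0<..<1}"
      unfolding assms(4,5) using assms(1-3) by (simp_all add: field_simps)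
  qed
  have q: "poly ?q x = - poly p (1 - x)" for x
    by (rule poly_neg_pcompose_one_minus)
  \<comment> \<open>Reflection carries \<open>{0..1 - b}\<close> onto \<open>{b..1}\<close>; the
    lower bound -1 on \<open>?q\<close> becomes the upper bound 1 on \<open>p\<close>.\<close>
  have low: "(\<forall>x\<in>{0..1 - b}. - 1 \<le> poly ?q x \<and> poly ?q x \<le> poly ?q (1 - b) \<and> poly ?q (1 - b) < 0)
    \<longleftrightarrow> (\<forall>x\<in>{b..1}. 0 < poly p b \<and> poly p b \<le> poly p x \<and> poly p x \<le> 1)"
    using ball_reflect_interval[of 0 "1 - b" "\<lambda>x. 0 < poly p b \<and> poly p b \<le> poly p x \<and> poly p x \<le> 1" 1]
    unfolding q by auto
  have high: "(\<forall>x\<in>{1 - a..1}. 0 < poly ?q (1 - a) \<and> poly ?q (1 - a) \<le> poly ?q x \<and> poly ?q x \<le> 1)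
    \<longleftrightarrow> (\<forall>x\<in>{0..a}. - 1 \<le> poly p x \<and> poly p x \<le> poly p a \<and> poly p a < 0)"
    using ball_reflect_interval[of "1 - a" 1 "\<lambda>x. - 1 \<le> poly p x \<and> poly p x \<le> poly p a \<and> poly p a < 0" 1]
    unfolding q by auto
  have root: "poly ?q l' = 0 \<longleftrightarrow> poly p l = 0"
    unfolding q assms(4) by simp
  have "admissible l g p \<longleftrightarrow> admissible l' g' ?q"
    unfolding admissible_def a' b' low high root
    unfolding a_def[symmetric] b_def[symmetric]
    using range' assms(1-3) by blast
  \<comment> \<open>At \<open>1 - b\<close> and \<open>1 - a\<close> the values of \<open>?q\<close>
    are \<open>- poly p b\<close> and \<open>- poly p a\<close>, so both minima range over the same
    two numbers in opposite order.\<close>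
  moreover have "admissible_gap l g p = admissible_gap l' g' ?q"
    unfolding admissible_gap_def a' b' q
    by (simp add: a_def b_def min.commute)
  ultimately show ?thesis by blast
qed

end
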